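(* Let $k \ge 1$ and $\theta = 2\pi/(4k+5)$, and write $s = \sec(\theta/2)$. For every $\varepsilon > 0$ there exist a finite point set $P$ in general position and $u, w \in P$ such that the shortest path between $u$ and $w$ in the $\theta_{4k+5}$-graph on $P$ has length at least $(L - \varepsilon)|uw|$, where $$L = \tfrac12\sqrt{4s + 7s^2 + 4s^3 + s^4 - 8\cos(\theta/2) - 4} + \tan(\theta/2) + \tfrac12 s\tan(\theta/2).$$ That is, the worst-case spanning ratio of $\theta_{4k+5}$-graphs is at least $L$.
   Context: Cones: for $m \ge 2$, $\theta = 2\pi/m$; around each point $u$ draw $m$ rays with consecutive angular separation $\theta$, oriented so the vertical upward ray from $u$ bisects a cone $C_0^u$; cones numbered clockwise, same orientation at every point. General position: no two points on a line parallel to a cone boundary ray, no two on a line perpendicular to a cone bisector, no three collinear. The $\theta_m$-graph on $P$: for each $u\in P$ and each cone $C_i^u$ containing another point of $P$, add an edge from $u$ to the point of $C_i^u$ whose orthogonal projection onto the bisector of $C_i^u$ is closest to $u$; edges weighted by Euclidean length. *)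

theory Defs
  imports Complex_Main
begin

text \<open>Points of the plane are complex numbers. Angles measured counterclockwise
from the positive real axis. For m cones, theta = 2 pi / m; cone C_i has bisector
direction at angle pi/2 - i*theta (C_0 bisected by the upward ray, numbered clockwise).\<close>

definition cone_angle :: "nat \<Rightarrow> real" where
  "cone_angle m = 2 * pi / real m"

definition bisector :: "nat \<Rightarrow> nat \<Rightarrow> complex" where
  "bisector m i = cis (pi / 2 - real i * cone_angle m)"

text \<open>Cone C_i^u (half-open in angle; boundary conventions are irrelevant under
general position).\<close>
definition in_cone :: "nat \<Rightarrow> nat \<Rightarrow> complex \<Rightarrow> complex \<Rightarrow> bool" where
  "in_cone m i u v \<longleftrightarrow>
     (\<exists>r \<phi>. r > 0 \<and> - cone_angle m / 2 \<le> \<phi> \<and> \<phi> < cone_angle m / 2 \<and>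
        v - u = complex_of_real r * cis (pi / 2 - real i * cone_angle m + \<phi>))"

definition proj_len :: "nat \<Rightarrow> nat \<Rightarrow> complex \<Rightarrow> complex \<Rightarrow> real" where
  "proj_len m i u v = Re ((v - u) * cnj (bisector m i))"

definition cross :: "complex \<Rightarrow> complex \<Rightarrow> real" where
  "cross a b = Re a * Im b - Im a * Re b"

definition general_position :: "nat \<Rightarrow> complex set \<Rightarrow> bool" where
  "general_position m P \<longleftrightarrow>
     (\<forall>u\<in>P. \<forall>v\<in>P. u \<noteq> v \<longrightarrow>
        (\<forall>j<m. cross (v - u) (cis (pi / 2 + cone_angle m / 2 - real j * cone_angle m)) \<noteq> 0) \<and>
        (\<forall>i<m. Re ((v - u) * cnj (bisector m i)) \<noteq> 0)) \<and>
     (\<forall>u\<in>P. \<forall>v\<in>P. \<forall>x\<in>P. u \<noteq> v \<and> u \<noteq> x \<and> v \<noteq> x \<longrightarrow> cross (v - u) (x - u) \<noteq> 0)"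

definition theta_edge :: "nat \<Rightarrow> complex set \<Rightarrow> complex \<Rightarrow> complex \<Rightarrow> bool" where
  "theta_edge m P u v \<longleftrightarrow> u \<in> P \<and> v \<in> P \<and>
     (\<exists>i<m. in_cone m i u v \<and>
        (\<forall>x\<in>P. in_cone m i u x \<longrightarrow> proj_len m i u v \<le> proj_len m i u x))"

definition theta_graph_adj :: "nat \<Rightarrow> complex set \<Rightarrow> complex \<Rightarrow> complex \<Rightarrow> bool" where
  "theta_graph_adj m P u v \<longleftrightarrow> theta_edge m P u v \<or> theta_edge m P v u"

definition theta_path :: "nat \<Rightarrow> complex set \<Rightarrow> complex \<Rightarrow> complex \<Rightarrow> complex list \<Rightarrow> bool" where
  "theta_path m P u w ps \<longleftrightarrow> ps \<noteq> [] \<and> hd ps = u \<and> last ps = w \<and> set ps \<subseteq> P \<and>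
     (\<forall>j. Suc j < length ps \<longrightarrow> theta_graph_adj m P (ps ! j) (ps ! Suc j))"

definition path_length :: "complex list \<Rightarrow> real" where
  "path_length ps = sum_list (map (\<lambda>(a, b). cmod (b - a)) (zip ps (tl ps)))"

end

(* Take u = 0, w = 1, so that the segment uw makes the angle t / 2 with the bisectors of the cones
   at u and at w containing it, where t = theta / 2, and the reflection z' = 1 - cnj z permutes the cone directions.
   Write T_xy for the triangle cut off from the cone of x containing y by the perpendicular to
   its bisector through y. Put p at the far corner of T_uw, q at the far corner of T_pw and
   r at the far corner of T_wp, moved slightly into the interiors of these triangles, and add
   the reflections p', q', r'. These points destroy the edges uw, uq, q'w, qq', wp, up'. A
   potential that is 1-Lipschitz on all other pairs, with value 0 at u and |ur| + |rw| = L at w,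
   bounds every path from below. A final generic perturbation gives general position. *)
theory Submission
  imports Defs "HOL-Computational_Algebra.Polynomial"
begin

section \<open>Blocked edges\<close>

text \<open>Two angles of one vector differ by a multiple of 2 pi, so the integer
  \<open>j - i - n * m\<close> times \<open>h\<close> is a difference of two offsets from a
  half-open interval of length \<open>h\<close>. That integer is therefore 0, and |j - i| < m
  excludes wrapping around.\<close>

lemma in_cone_unique:
  assumes m: "0 < m" and "i < m" "j < m" and 1: "in_cone m i u v" and 2: "in_cone m j u v"
  shows "i = j"
proof -
  define h where "h = cone_angle m"
  have h: "real m * h = 2 * pi" "h > 0" using m by (auto simp: h_def cone_angle_def)
  obtain r \<phi> where r: "r > 0" "- h/2 \<le> \<phi>" "\<phi> < h/2" "v - u = complex_of_real r * cis (pi / 2 - real i * h + \<phi>)"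
    using 1 unfolding in_cone_def h_def by blast
  obtain r' \<phi>' where r': "r' > 0" "- h/2 \<le> \<phi>'" "\<phi>' < h/2" "v - u = complex_of_real r' * cis (pi / 2 - real j * h + \<phi>')"
    using 2 unfolding in_cone_def h_def by blast
  have "cmod (v - u) = r" "cmod (v - u) = r'"
    using r(1) r'(1) by (subst r(4) r'(4); simp add: norm_mult)+
  then have "cis (pi / 2 - real i * h + \<phi>) = cis (pi / 2 - real j * h + \<phi>')"
    using r r' by simp
  then have "sin (pi / 2 - real i * h + \<phi>) = sin (pi / 2 - real j * h + \<phi>') \<and> cos (pi / 2 - real i * h + \<phi>) = cos (pi / 2 - real j * h + \<phi>')"
    by (metis Im_complex_of_real cis.sel)
  then obtain n :: int where "pi / 2 - real i * h + \<phi> = pi / 2 - real j * h + \<phi>' + 2 * pi * n"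
    using sin_cos_eq_iff by blast
  then have eq: "(real_of_int (int j - int i - n * int m)) * h = \<phi>' - \<phi>"
    using h(1) by (simp add: algebra_simps)
  have "\<bar>real_of_int (int j - int i - n * int m) * h\<bar> < h"
    unfolding eq using r r' by linarith
  then have "\<bar>real_of_int (int j - int i - n * int m)\<bar> * h < 1 * h"
    using h by (simp only: abs_mult abs_of_pos mult_1)
  then have "\<bar>int j - int i - n * int m\<bar> < 1"
    using h by (simp only: mult_less_cancel_right_pos)
  then have "int j - int i = n * int m" by simp
  moreover have "\<bar>int j - int i\<bar> < int m" using assms by auto
  ultimately have "\<bar>n\<bar> * int m < 1 * int m" by (metis abs_mult abs_of_nat mult_1)
  then have "n = 0" using m by (simp only: mult_less_cancel_right_pos)
  with \<open>int j - int i = n * int m\<close> show ?thesis by simp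
qed

text \<open>\<open>z * cnj b\<close> expresses \<open>z\<close> in the frame whose first axis is the
  bisector \<open>b\<close>. The tangent condition is multiplied through by \<open>cos t\<close> to
  avoid a division, and strictness makes it stable under small moves.\<close>

definition open_cone :: "real \<Rightarrow> complex \<Rightarrow> complex \<Rightarrow> bool" where
  "open_cone t b z \<longleftrightarrow> \<bar>Im (z * cnj b)\<bar> * cos t < Re (z * cnj b) * sin t"

text \<open>The point \<open>z\<close> prevents \<open>x\<close> from choosing an edge to \<open>y\<close> in its cone with bisector \<open>b\<close>.\<close>

definition blocks :: "real \<Rightarrow> complex \<Rightarrow> complex \<Rightarrow> complex \<Rightarrow> complex \<Rightarrow> bool" where
  "blocks t b x y z \<longleftrightarrow> open_cone t b (y - x) \<and> open_cone t b (z - x) \<and>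
     Re ((z - x) * cnj b) < Re ((y - x) * cnj b)"

lemma open_cone_Re_pos:
  assumes "open_cone t b z" "0 < sin t" "0 < cos t"
  shows "0 < Re (z * cnj b)"
proof -
  have "0 \<le> \<bar>Im (z * cnj b)\<bar> * cos t" using assms(3) by simp
  then have "0 < Re (z * cnj b) * sin t" using assms(1) unfolding open_cone_def by linarith
  then show ?thesis using assms(2) by (simp add: zero_less_mult_iff)
qed

text \<open>The signed angle of \<open>v - u\<close> from the bisector is
  \<open>arctan (y / x)\<close>, and the cone inequality puts it strictly between \<open>- t\<close>
  and \<open>t\<close>. The bound \<open>m \<ge> 3\<close> keeps \<open>t\<close> below pi /
  2.\<close>

lemma open_cone_imp_in_cone:
  assumes m: "m \<ge> 3" and oc: "open_cone (pi / real m) (bisector m i) (v - u)"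
  shows "in_cone m i u v"
proof -
  define t where "t = pi / real m"
  have "pi / real m \<le> pi / 3" using m by (intro divide_left_mono) auto
  then have t: "0 < t" "t < pi / 2" using m pi_gt_zero unfolding t_def by (simp, linarith)
  then have sc: "0 < sin t" "0 < cos t" by (auto simp: sin_gt_zero2 cos_gt_zero)
  define b where "b = bisector m i"
  define x where "x = Re ((v - u) * cnj b)"
  define y where "y = Im ((v - u) * cnj b)"
  have oc': "\<bar>y\<bar> * cos t < x * sin t"
    using oc unfolding open_cone_def t_def b_def x_def y_def by simp
  have x: "0 < x" using open_cone_Re_pos[OF oc] sc unfolding x_def b_def t_def by simp
  define \<phi> where "\<phi> = arctan (y / x)"
  have "\<bar>y / x\<bar> < tan t" using oc' x sc by (simp add: tan_def divide_simps abs_mult algebra_simps)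
  then have "arctan (- tan t) < \<phi>" "\<phi> < arctan (tan t)"
    unfolding \<phi>_def by (auto simp only: arctan_less_iff)
  then have \<phi>: "- t < \<phi>" "\<phi> < t" using t by (simp_all add: arctan_tan arctan_minus)
  have c: "0 < cos \<phi>" using \<phi> t by (intro cos_gt_zero_pi) auto
  have "sin \<phi> = y / x * cos \<phi>"
    using tan_arctan[of "y / x"] c unfolding \<phi>_def[symmetric] by (simp add: tan_def field_simps)
  then have "(v - u) * cnj b = complex_of_real (x / cos \<phi>) * cis \<phi>"
    using x c by (simp add: complex_eq_iff x_def y_def)
  then have "(v - u) * (cnj b * b) = complex_of_real (x / cos \<phi>) * (cis \<phi> * b)"
    by (simp add: mult_ac)
  moreover have "cnj b * b = 1" by (simp add: b_def bisector_def cis_cnj cis_mult)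
  ultimately have "v - u = complex_of_real (x / cos \<phi>) * cis (pi / 2 - real i * cone_angle m + \<phi>)"
    by (simp add: b_def bisector_def cis_mult add_ac)
  moreover have "0 < x / cos \<phi>" using x c by simp
  moreover have "cone_angle m / 2 = t" by (simp add: t_def cone_angle_def)
  ultimately show ?thesis unfolding in_cone_def using \<phi> by (metis less_imp_le minus_divide_left)
qed

text \<open>If \<open>x\<close> chose \<open>y\<close>, the cone used would be cone \<open>i\<close>
  by uniqueness, but \<open>z\<close> has a smaller projection in that cone.\<close>

lemma blocks_imp_not_theta_edge:
  assumes "m \<ge> 3" "i < m" "z \<in> P" "blocks (pi / real m) (bisector m i) x y z"
  shows "\<not> theta_edge m P x y"
proof
  assume "theta_edge m P x y"
  then obtain j where j: "j < m" "in_cone m j x y"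
    "\<And>v. v \<in> P \<Longrightarrow> in_cone m j x v \<Longrightarrow> proj_len m j x y \<le> proj_len m j x v"
    unfolding theta_edge_def by blast
  have "in_cone m i x y" "in_cone m i x z"
    using assms(1,4) open_cone_imp_in_cone unfolding blocks_def by blast+
  moreover from this have "i = j" using in_cone_unique[of m i j x y] assms j by auto
  ultimately have "proj_len m i x y \<le> proj_len m i x z" using j assms by blast
  then show False using assms(4) unfolding proj_len_def blocks_def by auto
qed

lemma open_cone_eventually:
  assumes "(Z \<longlongrightarrow> z) F" "open_cone t b z"
  shows "\<forall>\<^sub>F n in F. open_cone t b (Z n)"
proof -
  have "((\<lambda>n. Re (Z n * cnj b) * sin t - \<bar>Im (Z n * cnj b)\<bar> * cos t) \<longlongrightarrow>
      Re (z * cnj b) * sin t - \<bar>Im (z * cnj b)\<bar> * cos t) F"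
    using assms(1) by (intro tendsto_intros)
  from order_tendstoD(1)[OF this, of 0] show ?thesis
    using assms(2) unfolding open_cone_def by simp
qed

text \<open>All conditions are strict inequalities between continuous functions. This carries
  blocking over to the perturbed points in general position.\<close>

lemma blocks_eventually:
  assumes "(X \<longlongrightarrow> x) F" "(Y \<longlongrightarrow> y) F" "(Z \<longlongrightarrow> z) F" "blocks t b x y z"
  shows "\<forall>\<^sub>F n in F. blocks t b (X n) (Y n) (Z n)"
proof -
  have "((\<lambda>n. Re ((Y n - X n) * cnj b) - Re ((Z n - X n) * cnj b)) \<longlongrightarrow>
      Re ((y - x) * cnj b) - Re ((z - x) * cnj b)) F"
    using assms(1-3) by (intro tendsto_intros)
  then have "\<forall>\<^sub>F n in F. 0 < Re ((Y n - X n) * cnj b) - Re ((Z n - X n) * cnj b)"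
    by (rule order_tendstoD(1)) (use assms(4) in \<open>simp add: blocks_def\<close>)
  moreover have "\<forall>\<^sub>F n in F. open_cone t b (Y n - X n)" "\<forall>\<^sub>F n in F. open_cone t b (Z n - X n)"
    using assms unfolding blocks_def by (auto intro!: open_cone_eventually tendsto_diff)
  ultimately show ?thesis unfolding blocks_def by eventually_elim simp
qed

text \<open>The map turns a difference \<open>d\<close> into \<open>- cnj d\<close>. In the frame of
  \<open>- cnj b\<close> this conjugates the old coordinates, so only the sign of the transverse
  coordinate changes.\<close>

lemma blocks_reflect:
  assumes "blocks t b x y z"
  shows "blocks t (- cnj b) (1 - cnj x) (1 - cnj y) (1 - cnj z)"
proof -
  have *: "((1 - cnj v) - (1 - cnj x)) * cnj (- cnj b) = cnj ((v - x) * cnj b)" for v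
    by (simp add: algebra_simps)
  show ?thesis using assms unfolding blocks_def open_cone_def *
    by (simp only: cnj.sel abs_minus_cancel)
qed

text \<open>For \<open>\<tau> = \<plusminus> tan t\<close> and \<open>\<eta> = 0\<close> this is a corner of the triangle \<open>T\<^bsub>xy\<^esub>\<close>; for \<open>0 < \<eta> < 1\<close> it is an
interior point of the triangle near that corner.\<close>

definition corner :: "real \<Rightarrow> real \<Rightarrow> complex \<Rightarrow> complex \<Rightarrow> complex \<Rightarrow> complex" where
  "corner \<tau> \<eta> b x y = x + b * complex_of_real ((1 - \<eta>) * Re ((y - x) * cnj b)) * Complex 1 ((1 - \<eta>) * \<tau>)"

text \<open>In the frame of \<open>b\<close> the corner has abscissa \<open>(1 - \<eta>) * X\<close>
  and slope \<open>(1 - \<eta>) * \<tau>\<close>: one factor puts it in front of \<open>y\<close>,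
  the other strictly inside the cone.\<close>

lemma blocks_corner:
  assumes "0 < \<eta>" "\<eta> < 1" "0 < sin t" "0 < cos t" "cmod b = 1" "\<bar>\<tau>\<bar> = tan t"
    and oc: "open_cone t b (y - x)"
  shows "blocks t b x y (corner \<tau> \<eta> b x y)"
proof -
  define X where "X = Re ((y - x) * cnj b)"
  have X: "0 < X" using open_cone_Re_pos[OF oc] assms unfolding X_def by simp
  have "b * cnj b = 1" using assms(5) complex_norm_square[of b] by simp
  then have bb: "(b * w) * cnj b = w" for w by (metis mult.commute mult.left_commute mult_1)
  have eq: "(corner \<tau> \<eta> b x y - x) * cnj b = complex_of_real ((1 - \<eta>) * X) * Complex 1 ((1 - \<eta>) * \<tau>)"
    unfolding corner_def X_def[symmetric] mult.assoc[of b] by (simp only: add_diff_cancel_left' bb)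
  have "\<bar>(1 - \<eta>) * X * ((1 - \<eta>) * \<tau>)\<bar> * cos t = (1 - \<eta>) * ((1 - \<eta>) * X * sin t)"
    using X assms by (simp add: abs_mult tan_def)
  also have "\<dots> < 1 * ((1 - \<eta>) * X * sin t)"
    using X assms by (intro mult_strict_right_mono) auto
  finally have "open_cone t b (corner \<tau> \<eta> b x y - x)"
    unfolding open_cone_def eq by simp
  moreover have "(1 - \<eta>) * X < X" using X assms by simp
  ultimately show ?thesis using oc unfolding blocks_def eq X_def[symmetric] by simp
qed

section \<open>Generic perturbation\<close>

lemma cross_diff_left:
  "cross (a - b) c = cross a c - cross b c"
  by (simp add: cross_def algebra_simps)

lemma avoid_lines:
  assumes "finite A" "\<And>a d. (a, d) \<in> A \<Longrightarrow> d \<noteq> 0" "0 < \<delta>"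
  shows "\<exists>z. cmod (z - p) < \<delta> \<and> (\<forall>(a, d)\<in>A. cross (z - a) d \<noteq> 0)"
proof -
  \<comment> \<open>A line meets the parabola \<open>x \<mapsto> p + (x, x\<^sup>2)\<close> in at most two points.\<close>
  let ?z = "\<lambda>x::real. p + Complex x (x\<^sup>2)"
  have "finite {x. cross (?z x - a) d = 0}" if "(a, d) \<in> A" for a d
  proof -
    let ?f = "[:cross (p - a) d, Im d, - Re d:]"
    have "?f \<noteq> 0" using assms(2)[OF that] by (auto simp: complex_eq_iff)
    moreover have "{x. cross (?z x - a) d = 0} \<subseteq> {x. poly ?f x = 0}"
      by (auto simp: cross_def algebra_simps power2_eq_square)
    ultimately show ?thesis using poly_roots_finite finite_subset by blast
  qed
  then have "finite (\<Union>(a, d)\<in>A. {x. cross (?z x - a) d = 0})" using assms(1) by auto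
  \<comment> \<open>Keeping x below 1 makes the square of x at most x, so the displacement is at
    most 2 x, which is less than \<delta>.\<close>
  moreover have "infinite {0<..<min 1 (\<delta> / 2)}" using assms(3) by (simp add: infinite_Ioo)
  ultimately obtain x where x: "x \<in> {0<..<min 1 (\<delta> / 2)}"
    and nx: "x \<notin> (\<Union>(a, d)\<in>A. {x. cross (?z x - a) d = 0})"
    by (meson finite_subset subsetI)
  have "cmod (?z x - p) \<le> x + x\<^sup>2" using cmod_le[of "?z x - p"] x by simp
  also have "x\<^sup>2 \<le> x" using x by (simp add: power2_eq_square mult_left_le)
  finally have "cmod (?z x - p) < \<delta>" using x by simp
  then show ?thesis using nx by (intro exI[of _ "?z x"]) auto
qed

lemma general_position_insert:
  assumes P: "finite P" "general_position m P" and "0 < m" "0 < \<delta>"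
  shows "\<exists>z. cmod (z - p) < \<delta> \<and> z \<notin> P \<and> general_position m (insert z P)"
proof -
  let ?d = "\<lambda>j. cis (pi / 2 + cone_angle m / 2 - real j * cone_angle m)"
  \<comment> \<open>The new point must avoid finitely many lines: those through an old point along a
    cone boundary or perpendicular to a bisector, and those through two old points. The cross
    product with \<open>\<i> * b\<close> is the projection onto \<open>b\<close>.\<close>
  let ?A = "(P \<times> (?d ` {..<m})) \<union> (P \<times> ((\<lambda>i. \<i> * bisector m i) ` {..<m})) \<union>
     (\<lambda>(u, v). (u, v - u)) ` {(u, v). u \<in> P \<and> v \<in> P \<and> u \<noteq> v}"
  have "finite {(u, v). u \<in> P \<and> v \<in> P \<and> u \<noteq> v}"
    by (rule finite_subset[of _ "P \<times> P"]) (use P in auto)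
  then have "finite ?A" using P(1) by auto
  moreover have "d \<noteq> 0" if "(a, d) \<in> ?A" for a d
    using that by (auto simp: bisector_def)
  ultimately obtain z where z: "cmod (z - p) < \<delta>" "\<forall>(a, d)\<in>?A. cross (z - a) d \<noteq> 0"
    using avoid_lines[of ?A \<delta> p] assms(4) by blast
  have z1: "cross (z - u) (?d j) \<noteq> 0" if "u \<in> P" "j < m" for u j using z(2) that by blast
  have z2: "cross (z - u) (\<i> * bisector m i) \<noteq> 0" if "u \<in> P" "i < m" for u i using z(2) that by blast
  have z3: "cross (z - u) (v - u) \<noteq> 0" if "u \<in> P" "v \<in> P" "u \<noteq> v" for u v
  proof -
    have "(u, v - u) \<in> ?A" using that by auto
    then show ?thesis using z(2) by blast
  qed
  have nz: "z \<notin> P" using z1[of z 0] assms(3) by (auto simp: cross_def)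
  have z1': "cross (u - z) (?d j) \<noteq> 0" if "u \<in> P" "j < m" for u j
    using z1[OF that] by (simp add: cross_diff_left)
  have z2': "Re ((u - z) * cnj (bisector m i)) \<noteq> 0 \<and> Re ((z - u) * cnj (bisector m i)) \<noteq> 0"
    if "u \<in> P" "i < m" for u i
    using z2[OF that] by (auto simp: cross_def algebra_simps)
  have z3': "cross (z - u) (v - u) \<noteq> 0 \<and> cross (v - u) (z - u) \<noteq> 0 \<and> cross (u - z) (v - z) \<noteq> 0"
    if "u \<in> P" "v \<in> P" "u \<noteq> v" for u v
    using z3[OF that] by (auto simp: cross_def algebra_simps)
  have "general_position m (insert z P)"
    unfolding general_position_def
  proof (intro conjI ballI impI allI)
    fix u v j assume "u \<in> insert z P" "v \<in> insert z P" "u \<noteq> v" "j < m"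
    then show "cross (v - u) (?d j) \<noteq> 0"
      using z1 z1' P(2) unfolding general_position_def by (metis insert_iff)
  next
    fix u v i assume "u \<in> insert z P" "v \<in> insert z P" "u \<noteq> v" "i < m"
    then show "Re ((v - u) * cnj (bisector m i)) \<noteq> 0"
      using z2' P(2) unfolding general_position_def by (metis insert_iff)
  next
    fix u v x assume *: "u \<in> insert z P" "v \<in> insert z P" "x \<in> insert z P" "u \<noteq> v \<and> u \<noteq> x \<and> v \<noteq> x"
    then consider "u \<in> P" "v \<in> P" "x \<in> P" | "u = z" "v \<in> P" "x \<in> P" | "u \<in> P" "v = z" "x \<in> P"
      | "u \<in> P" "v \<in> P" "x = z" by blast
    then show "cross (v - u) (x - u) \<noteq> 0"
    proof cases
      case 1 then show ?thesis using * P(2) unfolding general_position_def by blast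
    qed (use * z3' in auto)
  qed
  then show ?thesis using z(1) nz by blast
qed

text \<open>Points are moved one at a time. Injectivity is kept because the potential lives on
  indices and is later read off from the points.\<close>

lemma general_position_dense:
  fixes c :: "nat \<Rightarrow> complex"
  assumes "0 < m" "0 < \<delta>"
  shows "\<exists>c'. (\<forall>i<n. cmod (c' i - c i) < \<delta>) \<and> inj_on c' {..<n} \<and> general_position m (c' ` {..<n})"
proof (induction n)
  case 0
  then show ?case by (auto simp: general_position_def)
next
  case (Suc n)
  then obtain c' where c': "\<forall>i<n. cmod (c' i - c i) < \<delta>" "inj_on c' {..<n}" "general_position m (c' ` {..<n})"
    by blast
  obtain z where z: "cmod (z - c n) < \<delta>" "z \<notin> c' ` {..<n}" "general_position m (insert z (c' ` {..<n}))"
    using general_position_insert[OF _ c'(3) assms, of "c n"] by auto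
  let ?c = "c'(n := z)"
  have "?c ` {..<Suc n} = insert z (c' ` {..<n})" by (auto simp: lessThan_Suc)
  moreover have "?c n \<notin> ?c ` {..<n}" using z(2) by auto
  moreover have "inj_on ?c {..<n}" using c'(2) by (auto simp: inj_on_def)
  ultimately have "inj_on ?c {..<Suc n} \<and> general_position m (?c ` {..<Suc n})"
    using z(3) by (simp add: lessThan_Suc del: fun_upd_apply)
  moreover have "\<forall>i<Suc n. cmod (?c i - c i) < \<delta>" using c'(1) z(1) by (auto simp: less_Suc_eq)
  ultimately show ?case by blast
qed

section \<open>Lower bound for path lengths from a potential\<close>

lemma path_length_ge_potential:
  assumes "ps \<noteq> []" "\<And>j. Suc j < length ps \<Longrightarrow> F (ps ! Suc j) - F (ps ! j) \<le> cmod (ps ! Suc j - ps ! j)"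
  shows "F (last ps) - F (hd ps) \<le> path_length ps"
  using assms
proof (induction ps rule: induct_list012)
  case (3 x y zs)
  have "F (last (y # zs)) - F (hd (y # zs)) \<le> path_length (y # zs)"
    by (rule 3(2)) (use 3(4)[of "Suc _"] in auto)
  moreover have "F y - F x \<le> cmod (y - x)" using 3(4)[of 0] by simp
  moreover have "path_length (x # y # zs) = cmod (y - x) + path_length (y # zs)"
    by (simp add: path_length_def)
  ultimately show ?case by simp
qed (auto simp: path_length_def)

section \<open>The potential\<close>

text \<open>The indices 0 to 7 stand for \<open>u, w, p, q, r, p', q', r'\<close>; the prime is the reflection
\<open>z \<mapsto> 1 - cnj z\<close>.\<close>

definition config :: "complex \<Rightarrow> complex \<Rightarrow> complex \<Rightarrow> nat \<Rightarrow> complex" where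
  "config p q r i = [0, 1, p, q, r, 1 - cnj p, 1 - cnj q, 1 - cnj r] ! i"

text \<open>Both orientations are listed because an edge is absent only when neither endpoint
  selects the other.\<close>

definition non_edges :: "(nat \<times> nat) set" where
  "non_edges = {(0,1), (0,3), (6,1), (6,3), (1,2), (2,1), (1,0), (1,6), (3,0), (3,6), (0,5), (5,0)}"

text \<open>\<open>M = |ur|\<close>, \<open>D = |rw| = |pq|\<close> and \<open>e = |pr| = |qw|\<close>. The potential is antisymmetric
about \<open>(M + D) / 2\<close> under the reflection.\<close>

definition potential :: "real \<Rightarrow> real \<Rightarrow> real \<Rightarrow> nat \<Rightarrow> real" where
  "potential M D e i = [0, M + D, M - e, M + D - e, M, D + e, e, D] ! i"

lemma less_8_cases: "(i::nat) < 8 \<Longrightarrow> i = 0 \<or> i = 1 \<or> i = 2 \<or> i = 3 \<or> i = 4 \<or> i = 5 \<or> i = 6 \<or> i = 7"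
  by arith

text \<open>The pairs ur, rw, pr, qw, pq and their reflections are tight. The other pairs follow
  from triangle inequalities through these; the bounds \<open>b\<close> settle the signs of the
  differences and one direction for the pair p, p'.\<close>

lemma potential_lipschitz:
  assumes M: "cmod r = M" and D: "cmod (r - 1) = D" and e: "cmod (r - p) = e"
    and e': "cmod (q - 1) = e" and D': "cmod (q - p) = D"
    and b: "1 \<le> M" "D + e \<le> 1" "2 * e \<le> 1" "D + 2 * e \<le> M + cmod (p - (1 - cnj p))"
    and ij: "i < 8" "j < 8" "(i, j) \<notin> non_edges"
  shows "\<bar>potential M D e i - potential M D e j\<bar> \<le> cmod (config p q r i - config p q r j)"
proof -
  define K where "K i j \<longleftrightarrow> \<bar>potential M D e i - potential M D e j\<bar> \<le> cmod (config p q r i - config p q r j)" for i j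
  have sym: "K i j \<longleftrightarrow> K j i" for i j unfolding K_def by (simp add: abs_minus_commute norm_minus_commute)
  have refl: "K i i" for i unfolding K_def by simp
  have refl_dist: "cmod (cnj a - cnj b) = cmod (a - b)" for a b
    by (metis complex_cnj_diff complex_mod_cnj)
  have flip: "cmod (a - (1 - cnj b)) = cmod (b - (1 - cnj a))" for a b
    using complex_mod_cnj[of "a - (1 - cnj b)"] by (simp add: algebra_simps)
  have pos: "0 \<le> D" "0 \<le> e" using D e by auto
  have tri: "cmod (x - z) \<le> cmod (x - y) + cmod (y - z)" for x y z
    by (rule norm_diff_triangle_ineq[of x y y z, simplified])
  have d1: "M - e \<le> cmod p" using tri[of r 0 p] M e by simp
  have d2: "cmod (1 - r) = D" "cmod (1 - q) = e" "cmod (p - q) = D" "cmod (p - r) = e"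
    using D D' e e' by (metis norm_minus_commute)+
  have d3: "M \<le> D + cmod (r - (1 - cnj r))"
    using tri[of r 0 "1 - cnj r"] M refl_dist[of 1 r] d2 by simp
  have d4: "cmod (r - (1 - cnj r)) \<le> e + cmod (p - (1 - cnj r))" using tri[of r "1 - cnj r" p] e by simp
  have d5: "cmod (p - (1 - cnj r)) \<le> cmod (p - (1 - cnj p)) + e"
    using tri[of p "1 - cnj r" "1 - cnj p"] refl_dist[of r p] e by simp
  have d6: "M \<le> e + cmod (p - (1 - cnj q)) + e"
    using tri[of r 0 "1 - cnj q"] tri[of r "1 - cnj q" p] e M refl_dist[of 1 q] d2 by simp
  have d7: "M \<le> e + cmod (q - (1 - cnj r))"
    using tri[of "1 - cnj r" 1 q] M e' by (simp add: norm_minus_commute)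
  have d8: "\<bar>D - e\<bar> \<le> cmod (q - r)"
    using tri[of r 1 q] tri[of q 1 r] D e' norm_minus_commute[of q r] by simp
  note f = K_def potential_def config_def
  \<comment> \<open>These are the 22 unordered pairs that remain of 28 after the six non-edges are
    removed. \<open>flip\<close> and \<open>refl_dist\<close> reduce mirror images to the bounds
    above.\<close>
  have K: "K 0 2" "K 0 4" "K 0 6" "K 0 7" "K 1 3" "K 1 4" "K 1 5" "K 1 7" "K 2 3" "K 2 4" "K 2 5"
    "K 2 6" "K 2 7" "K 3 4" "K 3 5" "K 3 7" "K 4 5" "K 4 6" "K 4 7" "K 5 6" "K 5 7" "K 6 7"
    using d1 b M pos D e e' D' d2 d3 d4 d5 d6 d7 d8
      flip[of q p] flip[of r p] flip[of r q] refl_dist[of 1 q] refl_dist[of 1 r]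
      refl_dist[of q p] refl_dist[of p q] refl_dist[of r p] refl_dist[of p r] refl_dist[of r q] refl_dist[of q r]
    by (auto simp: f norm_minus_commute[of 0] norm_minus_commute[of 1] abs_le_iff norm_minus_commute[of r q])
  have "K i j"
    using less_8_cases[OF ij(1)] less_8_cases[OF ij(2)] ij(3) K refl
    by (elim disjE; simp add: non_edges_def) (simp_all add: sym)
  then show ?thesis unfolding K_def .
qed

lemma corner_tendsto:
  assumes "(X \<longlongrightarrow> x) (at_right 0)" "(Y \<longlongrightarrow> y) (at_right 0)"
  shows "((\<lambda>\<eta>. corner \<tau> \<eta> b (X \<eta>) (Y \<eta>)) \<longlongrightarrow> corner \<tau> 0 b x y) (at_right 0)"
proof -
  have "((\<lambda>\<eta>. \<eta>) \<longlongrightarrow> 0) (at_right (0::real))" by (rule tendsto_ident_at)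
  then show ?thesis unfolding corner_def using assms by (intro tendsto_intros)
qed

section \<open>The limit configuration\<close>

text \<open>Everything reduces to \<open>(4 * k + 5) * t = pi\<close>, with \<open>t\<close> half
  the cone angle. Since the number of cones is odd, the downward ray is the common boundary of cones
  \<open>2 * k + 2\<close> and \<open>2 * k + 3\<close>.\<close>

lemma bisector_indices:
  fixes k :: nat
  defines "t \<equiv> pi / real (4 * k + 5)"
  shows "bisector (4 * k + 5) (k + 1) = cis (t / 2)"
    and "bisector (4 * k + 5) (3 * k + 4) = - cnj (cis (t / 2))"
    and "bisector (4 * k + 5) 0 = \<i>"
    and "bisector (4 * k + 5) (2 * k + 2) = cis (t - pi / 2)"
    and "bisector (4 * k + 5) (2 * k + 3) = - cnj (cis (t - pi / 2))"
proof -
  have t: "t * real (4 * k + 5) = pi" by (simp add: t_def)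
  then have t': "t * (4 * real k + 5) = pi" by simp
  have h: "cone_angle (4 * k + 5) = 2 * t" by (simp add: cone_angle_def t_def)
  have neg: "- cis x = cis (x - pi)" for x by (simp add: complex_eq_iff)
  have 1: "pi / 2 - real (k + 1) * (2 * t) = t / 2" using t' by (simp add: algebra_simps)
  have 2: "pi / 2 - real (3 * k + 4) * (2 * t) = - (t / 2) - pi" using t' by (simp add: algebra_simps)
  have 3: "pi / 2 - real (2 * k + 2) * (2 * t) = t - pi / 2" using t' by (simp add: algebra_simps)
  have 4: "pi / 2 - real (2 * k + 3) * (2 * t) = - (t - pi / 2) - pi" using t' by (simp add: algebra_simps)
  show "bisector (4 * k + 5) (k + 1) = cis (t / 2)" unfolding bisector_def h 1 ..
  show "bisector (4 * k + 5) (3 * k + 4) = - cnj (cis (t / 2))" unfolding bisector_def h 2 cis_cnj neg ..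
  show "bisector (4 * k + 5) 0 = \<i>" by (simp add: bisector_def)
  show "bisector (4 * k + 5) (2 * k + 2) = cis (t - pi / 2)" unfolding bisector_def h 3 ..
  show "bisector (4 * k + 5) (2 * k + 3) = - cnj (cis (t - pi / 2))" unfolding bisector_def h 4 cis_cnj neg ..
qed

text \<open>The limit positions of \<open>p, q, r\<close>; \<open>h0\<close> is the common height of \<open>p\<close> and \<open>r\<close> above \<open>uw\<close>.\<close>

definition e0 :: "real \<Rightarrow> real" where "e0 t = (1 - cos t) * (1 + 2 * cos t)\<^sup>2 / (2 * (cos t)\<^sup>2)"
definition h0 :: "real \<Rightarrow> real" where "h0 t = sin t + sin t / (2 * cos t)"
definition p0 :: "real \<Rightarrow> complex" where "p0 t = corner (tan t) 0 (cis (t / 2)) 0 1"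
definition q0 :: "real \<Rightarrow> complex" where "q0 t = corner (tan t) 0 (cis (t - pi / 2)) (p0 t) 1"
definition r0 :: "real \<Rightarrow> complex" where "r0 t = corner (- tan t) 0 \<i> 1 (p0 t)"

section \<open>Coordinates, numerical bounds and cone memberships of the limit points\<close>

lemma sin_sq: "(sin (t::real))\<^sup>2 = 1 - (cos t)\<^sup>2"
  by (simp add: sin_squared_eq)

context
  fixes t :: real
  assumes t_pos: "0 < t" and t_le: "t \<le> pi / 9"
begin

lemma sin_pos: "0 < sin t" and sin_half_pos: "0 < sin (t / 2)"
  and cos_half_pos: "0 < cos (t / 2)" and sin_3half_pos: "0 < sin (3 * t / 2)"
  and cos_3half_pos: "0 < cos (3 * t / 2)" and cos_lt_1: "cos t < 1" and cos_pos: "0 < cos t"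
  using t_pos t_le pi_gt_zero cos_monotone_0_pi[of 0 t]
  by (auto intro!: sin_gt_zero cos_gt_zero)

text \<open>At least nine cones means \<open>3 * t \<le> pi / 3\<close>, hence
  \<open>cos (3 * t) \<ge> 1 / 2\<close>; by the triple-angle formula a cosine below 93/100 would
  make this value too small.\<close>

lemma cos_ge: "93/100 \<le> cos t"
proof (rule ccontr)
  assume "\<not> 93/100 \<le> cos t"
  then have c: "cos t < 93/100" by simp
  have "cos (pi / 3) \<le> cos (3 * t)" using t_pos t_le by (intro cos_monotone_0_pi_le) auto
  then have "1 / 2 \<le> cos t * (4 * (cos t)\<^sup>2 - 3)"
    unfolding cos_60 cos_treble_cos by (simp add: power2_eq_square power3_eq_cube algebra_simps)
  moreover have "(cos t)\<^sup>2 \<le> (93/100)\<^sup>2" using c cos_pos by (intro power_mono) auto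
  then have "cos t * (4 * (cos t)\<^sup>2 - 3) \<le> cos t * (4596/10000)"
    using cos_pos by (intro mult_left_mono) (auto simp: power2_eq_square)
  ultimately show False using c by simp
qed

lemma sin_le: "sin t \<le> 37/100"
proof -
  have "(93/100)\<^sup>2 \<le> (cos t)\<^sup>2" using cos_ge by (intro power_mono) auto
  then have "(sin t)\<^sup>2 \<le> (37/100)\<^sup>2" using sin_sq by (simp add: power2_eq_square)
  then show ?thesis by (rule power2_le_imp_le) simp
qed

lemma half_angle:
  "cos (t / 2) * cos (t / 2) = (1 + cos t) / 2"
  "sin (t / 2) * sin (t / 2) = (1 - cos t) / 2"
  "sin (t / 2) * cos (t / 2) = sin t / 2"
  using cos_double_cos[of "t / 2"] cos_double_sin[of "t / 2"] sin_double[of "t / 2"]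
  by (auto simp: power2_eq_square)

text \<open>The factor \<open>Complex 1 (tan t)\<close> turns by \<open>t\<close>, so p lies on the
  boundary ray of the cone at u, at angle \<open>t / 2 + t\<close>.\<close>

lemma p0_cis: "p0 t = complex_of_real (cos (t / 2) / cos t) * cis (3 * t / 2)"
proof -
  have "Complex 1 (tan t) = cis t / complex_of_real (cos t)"
    using cos_pos by (simp add: complex_eq_iff tan_def)
  moreover have "cis (3 * t / 2) = cis (t / 2) * cis t" by (simp add: cis_mult)
  ultimately show ?thesis by (simp add: p0_def corner_def)
qed

lemma p0_eq: "p0 t = Complex ((2 * (cos t)\<^sup>2 - 1 + cos t) / (2 * cos t)) (h0 t)"
proof -
  let ?H = "sin (t / 2)" and ?C = "cos (t / 2)"
  have "Re (p0 t) = ?C * ?C - (?H * ?C) * sin t / cos t" "Im (p0 t) = ?H * ?C + ?C * ?C * sin t / cos t"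
    by (simp_all add: p0_def corner_def tan_def)
  then have "Re (p0 t) = (1 + cos t) / 2 - (sin t)\<^sup>2 / (2 * cos t)"
    "Im (p0 t) = sin t / 2 + (1 + cos t) / 2 * sin t / cos t"
    by (simp_all add: half_angle power2_eq_square)
  then show ?thesis
    using cos_pos unfolding sin_sq h0_def by (simp add: complex_eq_iff field_simps power2_eq_square)
qed

lemma q0_eq: "q0 t = 1 + complex_of_real (e0 t) * cis t"
proof -
  \<comment> \<open>With this factor p - 1 equals \<kappa> times \<open>cis t - 1\<close>, which
    removes the half angles and makes \<open>e0 t\<close> the squared distance from p to w.\<close>
  define \<kappa> where "\<kappa> = (1 + 2 * cos t) / (2 * cos t)"
  have p: "1 - Re (p0 t) = \<kappa> * (1 - cos t)" "Im (p0 t) = \<kappa> * sin t"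
    using cos_pos by (simp_all add: p0_eq h0_def \<kappa>_def field_simps power2_eq_square)
  have e: "e0 t = 2 * \<kappa>\<^sup>2 * (1 - cos t)"
    using cos_pos by (simp add: e0_def \<kappa>_def power_divide field_simps power2_eq_square)
  have k: "2 * cos t * \<kappa> = 1 + 2 * cos t" using cos_pos by (simp add: \<kappa>_def)
  have "Re ((1 - p0 t) * cnj (cis (t - pi / 2))) = (1 - Re (p0 t)) * sin t + Im (p0 t) * cos t"
    by (simp add: cos_diff sin_diff)
  then have X: "Re ((1 - p0 t) * cnj (cis (t - pi / 2))) = \<kappa> * sin t"
    unfolding p by (simp add: algebra_simps)
  have "q0 t = p0 t + cis (t - pi / 2) * complex_of_real (\<kappa> * sin t) * Complex 1 (tan t)"
    unfolding q0_def corner_def X by simp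
  then have q: "Re (q0 t) = Re (p0 t) + \<kappa> * sin t * (2 * sin t)"
    "Im (q0 t) = Im (p0 t) + \<kappa> * ((sin t)\<^sup>2 * sin t / cos t - cos t * sin t)"
    using cos_pos by (simp_all add: cos_diff sin_diff tan_def power2_eq_square algebra_simps)
  have "Re (q0 t) = 1 + e0 t * cos t"
  proof -
    have "\<kappa> * sin t * (2 * sin t) = 2 * \<kappa> * (sin t)\<^sup>2" by (simp add: power2_eq_square)
    then have "Re (q0 t) = 1 + \<kappa> * (1 - cos t) * (2 * (1 + cos t) - 1)"
      using q(1) p(1) unfolding sin_sq by (simp add: power2_eq_square algebra_simps)
    also have "2 * (1 + cos t) - 1 = 2 * cos t * \<kappa>" using k by simp
    finally show ?thesis by (simp add: e power2_eq_square)
  qed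
  moreover have "Im (q0 t) = e0 t * sin t"
  proof -
    have "Im (q0 t) = \<kappa> * sin t * (1 + (1 - (cos t)\<^sup>2) / cos t - cos t)"
      unfolding q p sin_sq by (simp add: algebra_simps)
    also have "1 + (1 - (cos t)\<^sup>2) / cos t - cos t = 2 * \<kappa> * (1 - cos t)"
      using cos_pos by (simp add: \<kappa>_def field_simps power2_eq_square)
    finally show ?thesis by (simp add: e power2_eq_square)
  qed
  ultimately show ?thesis by (simp add: complex_eq_iff)
qed

lemma r0_eq: "r0 t = Complex (1 + h0 t * tan t) (h0 t)"
  unfolding r0_def corner_def p0_eq by (simp add: complex_eq_iff)

lemma e0_pos: "0 < e0 t"
  unfolding e0_def using cos_pos cos_lt_1 by (simp add: zero_less_mult_iff)

text \<open>The factor \<open>(1 - cos t) * (1 + 2 * cos t)\<^sup>2\<close> in \<open>e0\<close>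
  equals \<open>1 - cos (3 * t)\<close>, which is at most 1/2.\<close>

lemma e0_le: "e0 t \<le> 3/10"
proof -
  have "cos (pi / 3) \<le> cos (3 * t)" using t_pos t_le by (intro cos_monotone_0_pi_le) auto
  then have "(1 - cos t) * (1 + 2 * cos t)\<^sup>2 \<le> 1 / 2"
    unfolding cos_60 cos_treble_cos by (simp add: power2_eq_square power3_eq_cube algebra_simps)
  moreover have "(93/100)\<^sup>2 \<le> (cos t)\<^sup>2" using cos_ge by (intro power_mono) auto
  then have "1/2 \<le> 3/10 * (2 * (cos t)\<^sup>2)" by (simp add: power2_eq_square)
  ultimately have "(1 - cos t) * (1 + 2 * cos t)\<^sup>2 \<le> 3/10 * (2 * (cos t)\<^sup>2)" by linarith
  then show ?thesis unfolding e0_def using cos_pos by (simp add: divide_le_eq)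
qed

text \<open>The constants 7/10 here and 3/10 in \<open>e0_le\<close> add up to 1, as
  \<open>potential_lipschitz\<close> requires of \<open>D + e\<close>.\<close>

lemma h0_le: "h0 t / cos t \<le> 7/10"
proof -
  have "h0 t / cos t = sin t * (1 / cos t + 1 / (2 * cos t * cos t))"
    unfolding h0_def using cos_pos by (simp add: field_simps)
  also have "\<dots> \<le> 37/100 * (100/93 + 1 / (2 * (93/100) * (93/100)))"
  proof (rule mult_mono)
    have "1 / cos t \<le> 1 / (93/100)" using cos_ge by (intro divide_left_mono) auto
    moreover have "1 / (2 * cos t * cos t) \<le> 1 / (2 * (93/100) * (93/100))"
      using cos_ge by (intro divide_left_mono mult_mono) auto
    ultimately show "1 / cos t + 1 / (2 * cos t * cos t) \<le> 100/93 + 1 / (2 * (93/100) * (93/100))"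
      by simp
  qed (use sin_le cos_pos in auto)
  also have "\<dots> \<le> 7/10" by simp
  finally show ?thesis .
qed

text \<open>These memberships are strict already in the limit, so they persist nearby. A corner seen
  from its own apex is only on the cone boundary in the limit; \<open>blocks_corner\<close> treats
  that case.\<close>

lemma open_cones:
  shows "open_cone t (cis (t / 2)) 1" "open_cone t (cis (t / 2)) (q0 t)"
    "open_cone t (cis (t / 2)) (p0 t - (1 - cnj (q0 t)))" "open_cone t (cis (t / 2)) (1 - (1 - cnj (q0 t)))"
    "open_cone t (cis (t / 2)) (q0 t - (1 - cnj (q0 t)))"
    "open_cone t \<i> (p0 t - 1)" "open_cone t (cis (t - pi / 2)) (1 - p0 t)"
proof -
  let ?H = "sin (t / 2)" and ?C = "cos (t / 2)"
  \<comment> \<open>By \<open>d1\<close> the direction of w has slack sin (t / 2) in the cone at u.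
    By \<open>d2\<close> the terms with \<open>e0 t\<close> in the claims about the reflected q cost
    only \<open>e0 t\<close> times that amount.\<close>
  have d1: "?C * sin t - ?H * cos t = ?H"
    using sin_diff[of t "t/2"] by (simp add: algebra_simps)
  have d2: "sin (3 * t / 2) * cos t - cos (3 * t / 2) * sin t = ?H"
    using sin_diff[of "3 * t / 2" t] by (simp add: algebra_simps)
  have pos: "0 < ?H * cos t" "0 < ?C * sin t" using sin_half_pos cos_half_pos sin_pos cos_pos by auto
  show 1: "open_cone t (cis (t / 2)) 1"
    using sin_half_pos d1 by (simp add: open_cone_def)
  have "q0 t * cnj (cis (t / 2)) = cis (- (t / 2)) + complex_of_real (e0 t) * cis (t / 2)"
    unfolding q0_eq by (simp add: distrib_right mult.assoc cis_cnj cis_mult)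
  then have q: "q0 t * cnj (cis (t / 2)) = Complex ((1 + e0 t) * ?C) (- ((1 - e0 t) * ?H))"
    by (simp add: complex_eq_iff algebra_simps)
  show "open_cone t (cis (t / 2)) (q0 t)"
  proof -
    have "(1 - e0 t) * (?H * cos t) \<le> 1 * (?H * cos t)"
      using e0_pos pos by (intro mult_right_mono) auto
    also have "\<dots> < 1 * (?C * sin t)" using d1 sin_half_pos by simp
    also have "\<dots> \<le> (1 + e0 t) * (?C * sin t)" using pos e0_pos by (intro mult_right_mono) auto
    finally show ?thesis
      using e0_le sin_half_pos by (simp add: open_cone_def q abs_mult algebra_simps)
  qed
  have "p0 t - (1 - cnj (q0 t)) = complex_of_real (?C / cos t) * cis (3 * t / 2) + complex_of_real (e0 t) * cis (- t)"
    unfolding q0_eq p0_cis by (simp add: cis_cnj)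
  then have "(p0 t - (1 - cnj (q0 t))) * cnj (cis (t / 2)) =
      complex_of_real (?C / cos t) * cis t + complex_of_real (e0 t) * cis (- (3 * t / 2))"
    by (simp only: distrib_right mult.assoc cis_cnj cis_mult) simp
  then have "(p0 t - (1 - cnj (q0 t))) * cnj (cis (t / 2)) =
      Complex (?C + e0 t * cos (3 * t / 2)) (?C * tan t - e0 t * sin (3 * t / 2))"
    using cos_pos by (simp add: complex_eq_iff tan_def)
  moreover have "\<bar>?C * tan t - e0 t * sin (3 * t / 2)\<bar> * cos t < (?C + e0 t * cos (3 * t / 2)) * sin t"
  proof -
    have x: "0 < e0 t * (sin (3 * t / 2) * cos t)" "0 < e0 t * (cos (3 * t / 2) * sin t)"
      using e0_pos sin_3half_pos cos_3half_pos sin_pos cos_pos by auto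
    have "e0 t * ?H \<le> 1 * ?H" using e0_le sin_half_pos by (intro mult_right_mono) auto
    moreover have "e0 t * (sin (3 * t / 2) * cos t) - e0 t * (cos (3 * t / 2) * sin t) = e0 t * ?H"
      by (simp flip: d2 right_diff_distrib)
    moreover have "?H < 2 * (?C * sin t)" using d1 pos by linarith
    ultimately have "\<bar>?C * sin t - e0 t * (sin (3 * t / 2) * cos t)\<bar> < ?C * sin t + e0 t * (cos (3 * t / 2) * sin t)"
      using x by linarith
    moreover have "\<bar>?C * tan t - e0 t * sin (3 * t / 2)\<bar> * cos t = \<bar>?C * sin t - e0 t * (sin (3 * t / 2) * cos t)\<bar>"
    proof -
      have "(?C * tan t - e0 t * sin (3 * t / 2)) * cos t = ?C * sin t - e0 t * (sin (3 * t / 2) * cos t)"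
        using cos_pos by (simp add: tan_def left_diff_distrib)
      then show ?thesis using cos_pos by (metis abs_mult abs_of_pos)
    qed
    ultimately show ?thesis by (simp add: algebra_simps)
  qed
  ultimately show "open_cone t (cis (t / 2)) (p0 t - (1 - cnj (q0 t)))"
    by (simp add: open_cone_def)
  have "(1 - (1 - cnj (q0 t))) * cnj (cis (t / 2)) =
      cis (- (t / 2)) + complex_of_real (e0 t) * cis (- (3 * t / 2))"
    unfolding q0_eq by (simp add: distrib_right mult.assoc cis_cnj cis_mult)
  then have "(1 - (1 - cnj (q0 t))) * cnj (cis (t / 2)) =
      Complex (?C + e0 t * cos (3 * t / 2)) (- (?H + e0 t * sin (3 * t / 2)))"
    by (simp add: complex_eq_iff)
  moreover have "(?H + e0 t * sin (3 * t / 2)) * cos t < (?C + e0 t * cos (3 * t / 2)) * sin t"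
  proof -
    have "e0 t * ?H < 1 * ?H" using e0_le sin_half_pos by (intro mult_strict_right_mono) auto
    moreover have "e0 t * (sin (3 * t / 2) * cos t) - e0 t * (cos (3 * t / 2) * sin t) = e0 t * ?H"
      by (simp flip: d2 right_diff_distrib)
    ultimately show ?thesis using d1 by (simp add: algebra_simps)
  qed
  moreover have "0 < ?H + e0 t * sin (3 * t / 2)" using sin_half_pos e0_pos sin_3half_pos by (simp add: add_pos_pos)
  ultimately show "open_cone t (cis (t / 2)) (1 - (1 - cnj (q0 t)))"
    by (simp add: open_cone_def add.commute)
  \<comment> \<open>A point and its mirror image have the same height, so this difference is a
    positive multiple of 1 and the first claim scales to it.\<close>
  have "q0 t - (1 - cnj (q0 t)) = complex_of_real (1 + 2 * e0 t * cos t)"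
    unfolding q0_eq by (simp add: complex_eq_iff)
  moreover have "0 < 1 + 2 * e0 t * cos t" using e0_pos cos_pos by (simp add: add_pos_pos)
  moreover have "open_cone t b (complex_of_real x * z)" if "0 < x" "open_cone t b z" for x b z
    using that by (simp add: open_cone_def abs_mult mult.assoc flip: distrib_left right_diff_distrib)
  ultimately show "open_cone t (cis (t / 2)) (q0 t - (1 - cnj (q0 t)))" using 1 by (metis mult_1_right)
  define \<kappa> where "\<kappa> = (1 + 2 * cos t) / (2 * cos t)"
  have \<kappa>: "0 < \<kappa>" using cos_pos by (simp add: \<kappa>_def)
  have p: "1 - Re (p0 t) = \<kappa> * (1 - cos t)" "Im (p0 t) = \<kappa> * sin t"
    using cos_pos by (simp_all add: p0_eq h0_def \<kappa>_def field_simps power2_eq_square)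
  \<comment> \<open>The segment wp makes the angle t / 2 with the bisectors at both of its ends; the
    inequality says tan (t / 2) < tan t and serves both remaining claims.\<close>
  have "(1 - cos t) * cos t < (1 - cos t) * (1 + cos t)" using cos_lt_1 by (intro mult_strict_left_mono) auto
  also have "\<dots> = sin t * sin t" using sin_sq by (simp add: power2_eq_square algebra_simps)
  finally have ineq: "(1 - cos t) * cos t < sin t * sin t" .
  have "(p0 t - 1) * cnj \<i> = Complex (\<kappa> * sin t) (\<kappa> * (1 - cos t))"
    using p by (simp add: complex_eq_iff)
  then show "open_cone t \<i> (p0 t - 1)"
    using \<kappa> ineq cos_lt_1 unfolding open_cone_def by (simp add: abs_mult mult.assoc)
  have X: "1 - p0 t = Complex (\<kappa> * (1 - cos t)) (- (\<kappa> * sin t))"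
    using p by (simp add: complex_eq_iff)
  have "\<kappa> * (1 - cos t) * cos t - \<kappa> * sin t * sin t = - (\<kappa> * (1 - cos t))"
    using sin_sq[of t] unfolding power2_eq_square by algebra
  then have "(1 - p0 t) * cnj (cis (t - pi / 2)) = Complex (\<kappa> * sin t) (- (\<kappa> * (1 - cos t)))"
    unfolding X by (simp add: complex_eq_iff cos_diff sin_diff algebra_simps)
  then show "open_cone t (cis (t - pi / 2)) (1 - p0 t)"
    using \<kappa> ineq cos_lt_1 unfolding open_cone_def by (simp add: abs_mult mult.assoc)
qed

end

text \<open>Since wp makes equal angles with the bisectors at its ends, T_pw and T_wp are congruent,
  whence |pq| = |rw| and |qw| = |pr|. The formula for |ur| is the law of cosines in the triangle
  uwr.\<close>

lemma ideal_dist: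
  fixes t :: real
  assumes "0 < t" "t \<le> pi / 9"
  shows "cmod (r0 t - 1) = h0 t / cos t" "cmod (r0 t - p0 t) = e0 t" "cmod (q0 t - 1) = e0 t"
    "cmod (q0 t - p0 t) = h0 t / cos t"
    "(cmod (r0 t))\<^sup>2 = 1 + 2 * (h0 t / cos t) * sin t + (h0 t / cos t)\<^sup>2"
    "cmod (p0 t - (1 - cnj (p0 t))) \<ge> 6/10"
proof -
  note a = assms
  note c = cos_pos[OF a] and s = sin_pos[OF a] and ss = sin_sq
  have h: "0 < h0 t" using c s by (simp add: h0_def add_pos_pos)
  note e = e0_pos[OF a]
  have r: "r0 t - 1 = complex_of_real (h0 t / cos t) * Complex (sin t) (cos t)"
    using c by (simp add: r0_eq[OF a] complex_eq_iff tan_def)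
  have n: "cmod (Complex (sin t) (cos t)) = 1" by (simp add: cmod_def)
  show "cmod (r0 t - 1) = h0 t / cos t" unfolding r norm_mult n norm_of_real using h c by simp
  show "cmod (q0 t - 1) = e0 t" unfolding q0_eq[OF a] using e by (simp add: norm_mult)
  have "h0 t * tan t = (1 - (cos t)\<^sup>2) * (1 / cos t + 1 / (2 * (cos t)\<^sup>2))"
    unfolding ss[symmetric] h0_def using c by (simp add: tan_def field_simps power2_eq_square)
  then have "1 + h0 t * tan t - (2 * (cos t)\<^sup>2 - 1 + cos t) / (2 * cos t) = e0 t"
    unfolding e0_def using c by (simp only:) (simp add: field_simps power2_eq_square)
  then have "r0 t - p0 t = complex_of_real (e0 t)"
    by (simp add: r0_eq[OF a] p0_eq[OF a] complex_eq_iff)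
  then show "cmod (r0 t - p0 t) = e0 t" using e by simp
  define \<kappa> where "\<kappa> = (1 + 2 * cos t) / (2 * cos t)"
  have hk: "h0 t = \<kappa> * sin t" using c by (simp add: h0_def \<kappa>_def field_simps)
  have ek: "e0 t = 2 * \<kappa>\<^sup>2 * (1 - cos t)"
    using c by (simp add: e0_def \<kappa>_def power_divide field_simps power2_eq_square)
  have pk: "Re (p0 t) = 1 - \<kappa> * (1 - cos t)"
    using c by (simp add: p0_eq[OF a] \<kappa>_def field_simps power2_eq_square)
  have kc: "cos t * \<kappa> = 1 / 2 + cos t" using c by (simp add: \<kappa>_def field_simps)
  \<comment> \<open>The unit vector is \<open>cis (2 * t - pi / 2)\<close>, a boundary direction of
    the cone at p with bisector \<open>cis (t - pi / 2)\<close>.\<close>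
  have "q0 t - p0 t = complex_of_real (\<kappa> * sin t / cos t) * Complex (sin (2 * t)) (- cos (2 * t))"
  proof -
    define x where "x = 2 * \<kappa> * (1 - cos t) - 1"
    have "e0 t * cos t + \<kappa> * (1 - cos t) = 2 * \<kappa> * (1 - (cos t)\<^sup>2)"
      using kc unfolding ek power2_eq_square by algebra
    then have "Re (q0 t - p0 t) = 2 * \<kappa> * (sin t)\<^sup>2"
      unfolding ss by (simp add: q0_eq[OF a] pk)
    then have "Re (q0 t - p0 t) = \<kappa> * sin t / cos t * sin (2 * t)"
      unfolding sin_double using c by (simp add: power2_eq_square)
    moreover have "Im (q0 t - p0 t) = \<kappa> * sin t * x"
      by (simp add: x_def q0_eq[OF a] p0_eq[OF a] hk ek power2_eq_square algebra_simps)
    moreover have "x * cos t = - cos (2 * t)"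
      unfolding cos_double_cos x_def using kc unfolding power2_eq_square by algebra
    then have "x = - cos (2 * t) / cos t" using c by (simp add: field_simps)
    ultimately show ?thesis by (simp add: complex_eq_iff)
  qed
  moreover have "cmod (Complex (sin (2 * t)) (- cos (2 * t))) = 1" by (simp add: cmod_def)
  ultimately have "cmod (q0 t - p0 t) = \<bar>\<kappa> * sin t / cos t\<bar>" by (simp only: norm_mult norm_of_real mult_1_right)
  then show "cmod (q0 t - p0 t) = h0 t / cos t" using h c by (simp add: hk)
  have "(cmod (r0 t))\<^sup>2 = (1 + h0 t / cos t * sin t)\<^sup>2 + (h0 t / cos t * cos t)\<^sup>2"
    using c by (simp add: cmod_power2 r0_eq[OF a] tan_def)
  also have "\<dots> = 1 + 2 * (h0 t / cos t) * sin t + (h0 t / cos t)\<^sup>2 * ((sin t)\<^sup>2 + (cos t)\<^sup>2)"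
    by (simp only: power2_eq_square) algebra
  finally show "(cmod (r0 t))\<^sup>2 = 1 + 2 * (h0 t / cos t) * sin t + (h0 t / cos t)\<^sup>2"
    by simp
  have "6/10 \<le> 2 * Re (p0 t) - 1"
  proof -
    have "\<kappa> \<le> 2" using cos_ge[OF a] c by (simp add: \<kappa>_def field_simps)
    then have "\<kappa> * (1 - cos t) \<le> 2 * (7/100)" using cos_ge[OF a] cos_lt_1[OF a] by (intro mult_mono) auto
    then show ?thesis unfolding pk by simp
  qed
  also have "\<dots> \<le> cmod (p0 t - (1 - cnj (p0 t)))"
    using complex_Re_le_cmod[of "p0 t - (1 - cnj (p0 t))"] by simp
  finally show "cmod (p0 t - (1 - cnj (p0 t))) \<ge> 6/10" .
qed

section \<open>Blocked configurations converging to the limit\<close>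

lemma config_tendsto:
  assumes "(p \<longlongrightarrow> p') F" "(q \<longlongrightarrow> q') F" "(r \<longlongrightarrow> r') F" "i < 8"
  shows "((\<lambda>x. config (p x) (q x) (r x) i) \<longlongrightarrow> config p' q' r' i) F"
  using less_8_cases[OF assms(4)] assms(1-3)
  by (elim disjE) (auto simp: config_def intro!: tendsto_intros)

text \<open>One parameter \<eta> pulls all three corners inward, with q and r built from the moved
  p. Blocking is strict for small positive \<eta>, whereas at 0 the corners only touch the boundary
  of their triangles.\<close>

lemma blocked_approximation:
  fixes k :: nat
  assumes "k \<ge> 1"
  defines "t \<equiv> pi / real (4 * k + 5)"
  shows "\<exists>p q r. (p \<longlongrightarrow> p0 t) (at_right 0) \<and> (q \<longlongrightarrow> q0 t) (at_right 0) \<and> (r \<longlongrightarrow> r0 t) (at_right (0::real)) \<and>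
    (\<forall>\<^sub>F \<eta> in at_right 0. \<forall>(i, j)\<in>non_edges. \<exists>l<4 * k + 5. \<exists>z<8.
       blocks t (bisector (4 * k + 5) l) (config (p \<eta>) (q \<eta>) (r \<eta>) i)
         (config (p \<eta>) (q \<eta>) (r \<eta>) j) (config (p \<eta>) (q \<eta>) (r \<eta>) z))"
proof -
  have "pi / real (4 * k + 5) \<le> pi / 9" using assms(1) by (intro divide_left_mono) auto
  then have a: "0 < t" "t \<le> pi / 9" by (auto simp: t_def)
  define b where "b = cis (t / 2)"
  define b' where "b' = cis (t - pi / 2)"
  define p where "p \<eta> = corner (tan t) \<eta> b 0 1" for \<eta>
  define q where "q \<eta> = corner (tan t) \<eta> b' (p \<eta>) 1" for \<eta>
  define r where "r \<eta> = corner (- tan t) \<eta> \<i> 1 (p \<eta>)" for \<eta>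
  let ?F = "at_right (0::real)"
  have lim: "(p \<longlongrightarrow> p0 t) ?F" unfolding p_def p0_def b_def by (intro corner_tendsto tendsto_const)
  have lim': "(q \<longlongrightarrow> q0 t) ?F" unfolding q_def q0_def b'_def by (intro corner_tendsto tendsto_const lim)
  have lim'': "(r \<longlongrightarrow> r0 t) ?F" unfolding r_def r0_def by (intro corner_tendsto tendsto_const lim)
  note oc = open_cones[OF a, folded b_def b'_def]
  have "((\<lambda>\<eta>. Re (q \<eta> * cnj b)) \<longlongrightarrow> Re (q0 t * cnj b)) ?F" by (intro tendsto_intros lim')
  \<comment> \<open>Along the bisector q lies beyond w, so whatever is in front of w is also in
    front of q.\<close>
  moreover have "Re (1 * cnj b) < Re (q0 t * cnj b)"
  proof -
    have "q0 t * cnj b = cis (- (t / 2)) + complex_of_real (e0 t) * cis (t / 2)"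
      unfolding q0_eq[OF a] b_def by (simp add: distrib_right mult.assoc cis_cnj cis_mult)
    then show ?thesis using e0_pos[OF a] cos_half_pos[OF a] by (simp add: b_def)
  qed
  ultimately have ev1: "\<forall>\<^sub>F \<eta> in ?F. Re (1 * cnj b) < Re (q \<eta> * cnj b)" by (rule order_tendstoD)
  have ev2: "\<forall>\<^sub>F \<eta> in ?F. 0 < \<eta> \<and> \<eta> < 1" by (simp add: eventually_at_right[of 0 1] exI[of _ 1])
  have ev3: "\<forall>\<^sub>F \<eta> in ?F. open_cone t b (q \<eta>)"
    "\<forall>\<^sub>F \<eta> in ?F. open_cone t b (p \<eta> - (1 - cnj (q \<eta>)))"
    "\<forall>\<^sub>F \<eta> in ?F. open_cone t b (1 - (1 - cnj (q \<eta>)))"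
    "\<forall>\<^sub>F \<eta> in ?F. open_cone t b (q \<eta> - (1 - cnj (q \<eta>)))"
    "\<forall>\<^sub>F \<eta> in ?F. open_cone t \<i> (p \<eta> - 1)"
    "\<forall>\<^sub>F \<eta> in ?F. open_cone t b' (1 - p \<eta>)"
    by (rule open_cone_eventually[OF _ oc(2)] open_cone_eventually[OF _ oc(3)]
        open_cone_eventually[OF _ oc(4)] open_cone_eventually[OF _ oc(5)]
        open_cone_eventually[OF _ oc(6)] open_cone_eventually[OF _ oc(7)],
        intro tendsto_intros lim lim')+
  have "\<forall>\<^sub>F \<eta> in ?F. \<forall>(i, j)\<in>non_edges. \<exists>l<4 * k + 5. \<exists>z<8.
       blocks t (bisector (4 * k + 5) l) (config (p \<eta>) (q \<eta>) (r \<eta>) i)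
         (config (p \<eta>) (q \<eta>) (r \<eta>) j) (config (p \<eta>) (q \<eta>) (r \<eta>) z)"
    using ev1 ev2 ev3
  proof eventually_elim
    case (elim \<eta>)
    let ?p = "p \<eta>" and ?q = "q \<eta>" and ?r = "r \<eta>"
    have tan: "0 < tan t" using sin_pos[OF a] cos_pos[OF a] by (simp add: tan_def)
    note bc = blocks_corner[OF _ _ sin_pos[OF a] cos_pos[OF a]]
    have B1: "blocks t b 0 1 ?p"
      unfolding p_def by (rule bc) (use elim oc(1) tan in \<open>auto simp: b_def\<close>)
    have B2: "blocks t b' ?p 1 ?q"
      unfolding q_def by (rule bc) (use elim tan in \<open>auto simp: b'_def\<close>)
    have B3: "blocks t \<i> 1 ?p ?r"
      unfolding r_def by (rule bc) (use elim tan in auto)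
    have B4: "blocks t b 0 ?q ?p"
      using B1 elim unfolding blocks_def by auto
    \<comment> \<open>Differences of projections do not depend on the apex, so passing to the
      reflected q only needs the cone memberships from \<open>elim\<close>.\<close>
    have B5: "blocks t b (1 - cnj ?q) 1 ?p" "blocks t b (1 - cnj ?q) ?q ?p"
      using B1 B4 elim unfolding blocks_def by (auto simp: algebra_simps)
    define c where "c = config ?p ?q ?r"
    let ?G = "\<lambda>i j. \<exists>l<4 * k + 5. \<exists>z<8. blocks t (bisector (4 * k + 5) l) (c i) (c j) (c z)"
    have G: "?G i j" if "blocks t (bisector (4 * k + 5) l) (c i) (c j) (c z)" "l < 4 * k + 5" "z < 8" for i j l z
      using that by blast
    note bi = bisector_indices[of k, folded t_def, folded b_def b'_def]
    note R = blocks_reflect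
    have "?G 0 1" by (rule G[of "k + 1" _ _ 2]) (use B1 bi in \<open>auto simp: c_def config_def\<close>)
    moreover have "?G 0 3" by (rule G[of "k + 1" _ _ 2]) (use B4 bi in \<open>auto simp: c_def config_def\<close>)
    moreover have "?G 6 1" by (rule G[of "k + 1" _ _ 2]) (use B5 bi in \<open>auto simp: c_def config_def\<close>)
    moreover have "?G 6 3" by (rule G[of "k + 1" _ _ 2]) (use B5 bi in \<open>auto simp: c_def config_def\<close>)
    moreover have "?G 1 2" by (rule G[of 0 _ _ 4]) (use B3 bi in \<open>auto simp: c_def config_def\<close>)
    moreover have "?G 2 1" by (rule G[of "2 * k + 2" _ _ 3]) (use B2 bi in \<open>auto simp: c_def config_def\<close>)
    \<comment> \<open>The remaining six are mirror images: reflection swaps cones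
      \<open>k + 1\<close> and \<open>3 * k + 4\<close>, swaps \<open>2 * k + 2\<close> and
      \<open>2 * k + 3\<close>, and fixes cone 0.\<close>
    moreover have "?G 1 0" by (rule G[of "3 * k + 4" _ _ 5]) (use R[OF B1] bi in \<open>auto simp: c_def config_def\<close>)
    moreover have "?G 1 6" by (rule G[of "3 * k + 4" _ _ 5]) (use R[OF B4] bi in \<open>auto simp: c_def config_def\<close>)
    moreover have "?G 3 0" by (rule G[of "3 * k + 4" _ _ 5]) (use R[OF B5(1)] bi in \<open>auto simp: c_def config_def\<close>)
    moreover have "?G 3 6" by (rule G[of "3 * k + 4" _ _ 5]) (use R[OF B5(2)] bi in \<open>auto simp: c_def config_def\<close>)
    moreover have "?G 0 5" by (rule G[of 0 _ _ 7]) (use R[OF B3] bi in \<open>auto simp: c_def config_def\<close>)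
    moreover have "?G 5 0" by (rule G[of "2 * k + 3" _ _ 6]) (use R[OF B2] bi in \<open>auto simp: c_def config_def\<close>)
    ultimately show ?case unfolding c_def[symmetric] non_edges_def by blast
  qed
  then show ?thesis using lim lim' lim'' by blast
qed

section \<open>Passage to general position and the final estimate\<close>

lemma dist_eventually:
  fixes c :: "nat \<Rightarrow> complex"
  assumes lim: "\<And>i. i < n \<Longrightarrow> ((\<lambda>x. Q x i) \<longlongrightarrow> c i) F"
    and "\<And>i j. i < n \<Longrightarrow> j < n \<Longrightarrow> R i j \<Longrightarrow> \<alpha> i j < cmod (c i - c j)"
  shows "\<forall>\<^sub>F x in F. \<forall>i<n. \<forall>j<n. R i j \<longrightarrow> \<alpha> i j < cmod (Q x i - Q x j)"
proof -
  have "\<forall>\<^sub>F x in F. R i j \<longrightarrow> \<alpha> i j < cmod (Q x i - Q x j)" if "i < n" "j < n" for i j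
  proof (cases "R i j")
    case True
    have "((\<lambda>x. cmod (Q x i - Q x j)) \<longlongrightarrow> cmod (c i - c j)) F"
      using lim that by (intro tendsto_intros)
    from order_tendstoD(1)[OF this] show ?thesis using assms(2) that True by simp
  qed simp
  then have "\<forall>\<^sub>F x in F. \<forall>i\<in>{..<n}. \<forall>j\<in>{..<n}. R i j \<longrightarrow> \<alpha> i j < cmod (Q x i - Q x j)"
    by (intro eventually_ball_finite ballI) auto
  then show ?thesis by (rule eventually_mono) auto
qed

theorem mainTheorem17:
  fixes k :: nat and \<epsilon> :: real
  assumes "k \<ge> 1" and "\<epsilon> > 0"
  defines "\<theta> \<equiv> 2 * pi / real (4 * k + 5)"
  defines "s \<equiv> 1 / cos (\<theta> / 2)"
  defines "L \<equiv> sqrt (4 * s + 7 * s ^ 2 + 4 * s ^ 3 + s ^ 4 - 8 * cos (\<theta> / 2) - 4) / 2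
                + tan (\<theta> / 2) + s * tan (\<theta> / 2) / 2"
  shows "\<exists>P u w. finite P \<and> general_position (4 * k + 5) P \<and> u \<in> P \<and> w \<in> P \<and> u \<noteq> w \<and>
           (\<forall>ps. theta_path (4 * k + 5) P u w ps \<longrightarrow>
                  path_length ps \<ge> (L - \<epsilon>) * cmod (w - u))"
proof -
  define m where "m = 4 * k + 5"
  define t where "t = pi / real m"
  have m: "m \<ge> 3" by (simp add: m_def)
  have "pi / real m \<le> pi / 9" using assms(1) by (intro divide_left_mono) (auto simp: m_def)
  then have a: "0 < t" "t \<le> pi / 9" using m by (auto simp: t_def)
  have th: "\<theta> / 2 = t" by (simp add: \<theta>_def t_def m_def field_simps)
  define D where "D = h0 t / cos t"
  define M where "M = cmod (r0 t)"
  define e where "e = e0 t"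
  note dist = ideal_dist[OF a, folded D_def M_def e_def]
  have c: "0 < cos t" and "0 < sin t" using cos_pos[OF a] sin_pos[OF a] .
  then have D: "0 < D" by (simp add: D_def h0_def add_pos_pos)
  have D': "D = tan t + s * tan t / 2"
    using c by (simp add: D_def h0_def s_def th tan_def add_divide_distrib)
  \<comment> \<open>The radical in \<open>L\<close> is twice |ur|. Grouping sine-free products as
    powers of \<open>cos t * s = 1\<close> turns the law of cosines into the stated
    polynomial.\<close>
  have "sqrt (4 * s + 7 * s ^ 2 + 4 * s ^ 3 + s ^ 4 - 8 * cos t - 4) = 2 * M"
  proof (rule real_sqrt_unique)
    have cs: "cos t * s = 1" using c by (simp add: s_def th)
    have "D * sin t = (sin t)\<^sup>2 * (s + s\<^sup>2 / 2)"
      using c by (simp add: D_def h0_def s_def th field_simps power2_eq_square)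
    then have Ds: "D * sin t = (1 - (cos t)\<^sup>2) * (s + s\<^sup>2 / 2)" by (simp only: sin_sq)
    have "D\<^sup>2 = (sin t)\<^sup>2 * (s + s\<^sup>2 / 2)\<^sup>2"
      using c by (simp add: D_def h0_def s_def th field_simps power2_eq_square)
    then have D2: "D\<^sup>2 = (1 - (cos t)\<^sup>2) * (s + s\<^sup>2 / 2)\<^sup>2" by (simp only: sin_sq)
    have "(2 * M)\<^sup>2 = 4 * (1 + 2 * (D * sin t) + D\<^sup>2)" using dist(5) by (simp add: mult.assoc)
    also have "\<dots> = 4 * s + 7 * s ^ 2 + 4 * s ^ 3 + s ^ 4 - 8 * cos t - 4"
    proof -
      have A: "(1 - (cos t)\<^sup>2) * (s + s\<^sup>2 / 2) = s + s\<^sup>2 / 2 - (cos t * s) * cos t - (cos t * s)\<^sup>2 / 2"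
        by (simp add: power2_eq_square field_simps)
      have B: "(1 - (cos t)\<^sup>2) * (s + s\<^sup>2 / 2)\<^sup>2 =
          (s + s\<^sup>2 / 2)\<^sup>2 - (cos t * s)\<^sup>2 * (1 + s / 2)\<^sup>2"
        by (simp add: power2_eq_square field_simps)
      show ?thesis unfolding Ds D2 A B cs
        by (simp add: power2_eq_square power3_eq_cube power4_eq_xxxx algebra_simps)
    qed
    finally show "(2 * M)\<^sup>2 = 4 * s + 7 * s ^ 2 + 4 * s ^ 3 + s ^ 4 - 8 * cos t - 4" .
  qed (simp add: M_def)
  then have L: "L = M + D" unfolding L_def th using D' by simp
  have "1 \<le> M\<^sup>2" using dist(5) D \<open>0 < sin t\<close> by simp
  then have M: "1 \<le> M" by (rule power2_le_imp_le[of 1 M, simplified]) (simp add: M_def)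
  have "D \<le> 7/10" using h0_le[OF a] by (simp add: D_def)
  moreover have "0 < e" "e \<le> 3/10" using e0_pos[OF a] e0_le[OF a] by (auto simp: e_def)
  ultimately have lip: "\<bar>potential M D e i - potential M D e j\<bar> \<le> cmod (config (p0 t) (q0 t) (r0 t) i - config (p0 t) (q0 t) (r0 t) j)"
    if "i < 8" "j < 8" "(i, j) \<notin> non_edges" for i j
    using that M dist by (intro potential_lipschitz) (auto simp: M_def)
  let ?f = "potential M D e"
  \<comment> \<open>Scaling the potential by \<open>1 - \<delta>\<close> creates room for
    perturbation, and \<open>1 + \<delta>\<close> will bound |uw|. The choice \<epsilon> / (2 L)
    makes the total loss at most \<epsilon>, as \<open>fin\<close> records.\<close>
  define \<delta> where "\<delta> = min (1/2) (\<epsilon> / (2 * L))"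
  have Lpos: "0 < L" using L M D by simp
  then have \<delta>: "0 < \<delta>" "\<delta> < 1" using assms(2) by (auto simp: \<delta>_def)
  have "\<delta> \<le> \<epsilon> / (2 * L)" by (simp add: \<delta>_def)
  then have "2 * (\<delta> * L) \<le> \<epsilon>" using Lpos by (simp add: field_simps)
  moreover have "0 < \<delta> * \<epsilon>" using \<delta> assms(2) by simp
  ultimately have fin: "(L - \<epsilon>) * (1 + \<delta>) \<le> (1 - \<delta>) * L" by (simp add: algebra_simps)

  \<comment> \<open>Pairs with equal potential are left out: they demand nothing of a path, and
    strictness would fail for \<open>i = j\<close>.\<close>
  define R where "R i j \<longleftrightarrow> (i, j) \<notin> non_edges \<and> ?f i \<noteq> ?f j" for i j
  define \<alpha> where "\<alpha> i j = (1 - \<delta>) * \<bar>?f i - ?f j\<bar>" for i j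
  define lengths where "lengths c \<longleftrightarrow> (\<forall>i<8. \<forall>j<8. R i j \<longrightarrow> \<alpha> i j < cmod (c i - c j))" for c
  define blocked where "blocked c \<longleftrightarrow> (\<forall>(i, j)\<in>non_edges. \<exists>l<m. \<exists>z<8. blocks t (bisector m l) (c i) (c j) (c z))" for c
  have "\<exists>c. lengths c \<and> blocked c \<and> c 0 = 0 \<and> c 1 = 1"
  proof -
    obtain p q r where pqr: "(p \<longlongrightarrow> p0 t) (at_right 0)" "(q \<longlongrightarrow> q0 t) (at_right 0)" "(r \<longlongrightarrow> r0 t) (at_right (0::real))"
      and ev: "\<forall>\<^sub>F \<eta> in at_right 0. blocked (config (p \<eta>) (q \<eta>) (r \<eta>))"
      using blocked_approximation[OF assms(1), folded m_def, folded t_def] unfolding blocked_def by blast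
    have "\<forall>\<^sub>F \<eta> in at_right 0. lengths (config (p \<eta>) (q \<eta>) (r \<eta>))"
      unfolding lengths_def
    proof (rule dist_eventually)
      show "((\<lambda>\<eta>. config (p \<eta>) (q \<eta>) (r \<eta>) i) \<longlongrightarrow> config (p0 t) (q0 t) (r0 t) i) (at_right 0)"
        if "i < 8" for i using config_tendsto[OF pqr that] .
    next
      fix i j :: nat assume *: "i < 8" "j < 8" "R i j"
      have "\<alpha> i j < 1 * \<bar>?f i - ?f j\<bar>"
        unfolding \<alpha>_def using \<delta> * by (intro mult_strict_right_mono) (auto simp: R_def)
      then show "\<alpha> i j < cmod (config (p0 t) (q0 t) (r0 t) i - config (p0 t) (q0 t) (r0 t) j)"
        using lip[of i j] * by (simp add: R_def)
    qed
    then have "\<forall>\<^sub>F \<eta> in at_right 0. lengths (config (p \<eta>) (q \<eta>) (r \<eta>)) \<and> blocked (config (p \<eta>) (q \<eta>) (r \<eta>))"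
      using ev by (rule eventually_conj)
    then obtain \<eta> where "lengths (config (p \<eta>) (q \<eta>) (r \<eta>)) \<and> blocked (config (p \<eta>) (q \<eta>) (r \<eta>))"
      using eventually_happens by force
    then show ?thesis by (intro exI[of _ "config (p \<eta>) (q \<eta>) (r \<eta>)"]) (simp add: config_def)
  qed
  then obtain c0 where c0: "lengths c0" "blocked c0" "c0 0 = 0" "c0 1 = 1" by blast
  \<comment> \<open>\<open>lengths\<close> and \<open>blocked\<close> amount to finitely many strict
    inequalities, so both survive moves of size \<open>1 / real (Suc n)\<close> into general
    position once \<open>n\<close> is large.\<close>
  have "\<exists>c. lengths c \<and> blocked c \<and> cmod (c 1 - c 0) < 1 + \<delta> \<and> inj_on c {..<8} \<and> general_position m (c ` {..<8})"
  proof -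
    have "\<forall>n. \<exists>c. (\<forall>i<8. cmod (c i - c0 i) < 1 / real (Suc n)) \<and> inj_on c {..<8} \<and> general_position m (c ` {..<8})"
      using general_position_dense m by auto
    then obtain Q where Q: "\<And>n i. i < 8 \<Longrightarrow> cmod (Q n i - c0 i) < 1 / real (Suc n)"
      "\<And>n. inj_on (Q n) {..<8}" "\<And>n. general_position m (Q n ` {..<8})" by metis
    have lim: "(\<lambda>n. Q n i) \<longlonglongrightarrow> c0 i" if "i < 8" for i
    proof (rule LIM_zero_cancel, rule tendsto_0_le)
      show "\<forall>\<^sub>F n in sequentially. cmod (Q n i - c0 i) \<le> norm (1 / real (Suc n)) * 1"
        using Q(1)[OF that] by (intro always_eventually allI less_imp_le) simp
      show "(\<lambda>n. 1 / real (Suc n)) \<longlonglongrightarrow> 0" using LIMSEQ_inverse_real_of_nat by (simp add: inverse_eq_divide)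
    qed
    have "\<forall>\<^sub>F n in sequentially. lengths (Q n)"
      unfolding lengths_def by (rule dist_eventually[OF lim]) (use c0(1) in \<open>auto simp: lengths_def\<close>)
    moreover have "\<forall>\<^sub>F n in sequentially. blocked (Q n)"
      unfolding blocked_def
    proof (intro eventually_ball_finite ballI)
      show "finite non_edges" by (simp add: non_edges_def)
      fix x assume "x \<in> non_edges"
      moreover obtain i j where x: "x = (i, j)" by force
      ultimately obtain l z where lz: "l < m" "z < 8" "blocks t (bisector m l) (c0 i) (c0 j) (c0 z)"
        using c0(2) unfolding blocked_def by blast
      have "i < 8" "j < 8" using \<open>x \<in> non_edges\<close> x by (auto simp: non_edges_def)
      from blocks_eventually[OF lim[OF this(1)] lim[OF this(2)] lim[OF lz(2)] lz(3)]
      show "\<forall>\<^sub>F n in sequentially. case x of (i, j) \<Rightarrow> \<exists>l<m. \<exists>z<8. blocks t (bisector m l) (Q n i) (Q n j) (Q n z)"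
        by (rule eventually_mono) (use lz x in auto)
    qed
    moreover have "\<forall>\<^sub>F n in sequentially. cmod (Q n 1 - Q n 0) < 1 + \<delta>"
    proof -
      have "(\<lambda>n. cmod (Q n 1 - Q n 0)) \<longlonglongrightarrow> cmod (c0 1 - c0 0)" by (intro tendsto_intros lim) auto
      then show ?thesis using \<delta> c0 by (intro order_tendstoD) auto
    qed
    ultimately have "\<forall>\<^sub>F n in sequentially. lengths (Q n) \<and> blocked (Q n) \<and> cmod (Q n 1 - Q n 0) < 1 + \<delta>"
      by eventually_elim simp
    then show ?thesis using Q(2,3) eventually_happens'[OF sequentially_bot] by blast
  qed
  then obtain c where cl: "lengths c" and cb: "blocked c" and c1: "cmod (c 1 - c 0) < 1 + \<delta>"
    and inj: "inj_on c {..<8}" and gp: "general_position m (c ` {..<8})" by blast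
  have not_adj: "\<not> theta_graph_adj m (c ` {..<8}) (c i) (c j)" if "(i, j) \<in> non_edges" for i j
  proof -
    have *: "\<not> theta_edge m (c ` {..<8}) (c i) (c j)" if ij: "(i, j) \<in> non_edges" for i j
    proof -
      obtain l z where "l < m" "z < 8" "blocks t (bisector m l) (c i) (c j) (c z)"
        using cb ij unfolding blocked_def by blast
      then show ?thesis using blocks_imp_not_theta_edge[OF m, of l "c z"] by (auto simp: t_def)
    qed
    have "(j, i) \<in> non_edges" using that by (auto simp: non_edges_def)
    then show ?thesis using * that unfolding theta_graph_adj_def by blast
  qed
  \<comment> \<open>Injectivity of \<open>c\<close> lets the potential pass from indices to
    points.\<close>
  define F where "F z = (1 - \<delta>) * ?f (inv_into {..<8} c z)" for z
  have F: "F (c i) = (1 - \<delta>) * ?f i" if "i < 8" for i using inj that by (simp add: F_def)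
  have path: "(L - \<epsilon>) * cmod (c 1 - c 0) \<le> path_length ps" if tp: "theta_path m (c ` {..<8}) (c 0) (c 1) ps" for ps
  proof -
    have "F (ps ! Suc j) - F (ps ! j) \<le> cmod (ps ! Suc j - ps ! j)" if j: "Suc j < length ps" for j
    proof -
      have adj: "theta_graph_adj m (c ` {..<8}) (ps ! j) (ps ! Suc j)"
        using tp j unfolding theta_path_def by blast
      then obtain i i' where i: "i < 8" "ps ! j = c i" "i' < 8" "ps ! Suc j = c i'"
        unfolding theta_graph_adj_def theta_edge_def by auto
      have "(i', i) \<notin> non_edges" using adj not_adj i by (auto simp: theta_graph_adj_def)
      then have "(1 - \<delta>) * \<bar>?f i' - ?f i\<bar> \<le> cmod (c i' - c i)"
        using cl i unfolding lengths_def R_def \<alpha>_def by (cases "?f i' = ?f i") (auto intro: less_imp_le)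
      moreover have "(1 - \<delta>) * (?f i' - ?f i) \<le> (1 - \<delta>) * \<bar>?f i' - ?f i\<bar>"
        using \<delta> by (intro mult_left_mono) auto
      ultimately show ?thesis using i by (simp add: F right_diff_distrib)
    qed
    then have "F (last ps) - F (hd ps) \<le> path_length ps"
      using tp by (intro path_length_ge_potential) (auto simp: theta_path_def)
    then have *: "(1 - \<delta>) * L \<le> path_length ps"
      using tp by (simp add: theta_path_def F potential_def L)
    show ?thesis
    \<comment> \<open>Replacing |uw| by its upper bound \<open>1 + \<delta>\<close> needs a
      nonnegative factor \<open>L - \<epsilon>\<close>; otherwise the claimed bound is at most
      0.\<close>
    proof (cases "L \<le> \<epsilon>")
      case True
      then have "(L - \<epsilon>) * cmod (c 1 - c 0) \<le> 0" by (intro mult_nonpos_nonneg) auto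
      also have "0 \<le> (1 - \<delta>) * L" using \<delta> Lpos by simp
      finally show ?thesis using * by simp
    next
      case False
      then have "(L - \<epsilon>) * cmod (c 1 - c 0) \<le> (L - \<epsilon>) * (1 + \<delta>)"
        using c1 by (intro mult_left_mono) auto
      then show ?thesis using fin * by linarith
    qed
  qed
  have "c 0 \<noteq> c 1" using inj_onD[OF inj, of 0 1] by auto
  then show ?thesis using gp path unfolding m_def
    by (intro exI[of _ "c ` {..<8}"] exI[of _ "c 0"] exI[of _ "c 1"]) auto
qed

end
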